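(* Let $\Gamma$ be a finitely generated group whose commutator subgroup $\Gamma'$ is contained in its Frattini subgroup $\Phi(\Gamma)$. Then for every finite inclusion-minimal generating set $C$ of $\Gamma$, the Cayley graph $\mathrm{Cay}(\Gamma,C)$ is $3$-colorable. In particular, this holds for every finitely generated nilpotent group $\Gamma$.
   Context: The commutator subgroup is $\Gamma'=\langle xyx^{-1}y^{-1}\mid x,y\in\Gamma\rangle$. The Frattini subgroup $\Phi(\Gamma)$ is the intersection of all maximal proper subgroups of $\Gamma$, and $\Phi(\Gamma)=\{e\}$ if $\Gamma$ has no maximal proper subgroups. For a group $\Gamma$ and a subset $C\subseteq\Gamma$, the Cayley graph $\mathrm{Cay}(\Gamma,C)$ is the undirected graph with vertex set $\Gamma$ in which $a,b$ are adjacent if $a^{-1}b\in C$ (undirected even if $C$ is not inverse-closed). *)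

theory Defs
  imports "HOL-Algebra.Algebra" "Graph_Theory.Graph_Theory"
begin

section \<open>Generating sets\<close>

definition finitely_generated :: "('a, 'b) monoid_scheme \<Rightarrow> bool" where
  "finitely_generated G \<longleftrightarrow>
     (\<exists>S. finite S \<and> S \<subseteq> carrier G \<and> generate G S = carrier G)"

definition minimal_generating_set :: "('a, 'b) monoid_scheme \<Rightarrow> 'a set \<Rightarrow> bool" where
  "minimal_generating_set G C \<longleftrightarrow>
     C \<subseteq> carrier G \<and> generate G C = carrier G \<and>
     (\<forall>D. D \<subset> C \<longrightarrow> generate G D \<noteq> carrier G)"

section \<open>Frattini subgroup\<close>

definition maximal_subgroup :: "'a set \<Rightarrow> ('a, 'b) monoid_scheme \<Rightarrow> bool" where
  "maximal_subgroup M G \<longleftrightarrow>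
     subgroup M G \<and> M \<noteq> carrier G \<and>
     (\<forall>H. subgroup H G \<and> M \<subseteq> H \<longrightarrow> H = M \<or> H = carrier G)"

text \<open>
  Convention: a group without maximal proper subgroups has trivial Frattini subgroup (many
  authors take the whole group instead).
\<close>

definition frattini :: "('a, 'b) monoid_scheme \<Rightarrow> 'a set" where
  "frattini G =
     (if \<exists>M. maximal_subgroup M G then \<Inter>{M. maximal_subgroup M G} else {\<one>\<^bsub>G\<^esub>})"

section \<open>Nilpotent groups\<close>

text \<open>Indexing starts at 0, so \<open>lower_central G 1\<close> is the commutator subgroup.\<close>

primrec lower_central :: "('a, 'b) monoid_scheme \<Rightarrow> nat \<Rightarrow> 'a set" where
  "lower_central G 0 = carrier G"
| "lower_central G (Suc n) =
     generate G {x \<otimes>\<^bsub>G\<^esub> y \<otimes>\<^bsub>G\<^esub> inv\<^bsub>G\<^esub> x \<otimes>\<^bsub>G\<^esub> inv\<^bsub>G\<^esub> y | x y.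
                   x \<in> lower_central G n \<and> y \<in> carrier G}"

definition nilpotent_group :: "('a, 'b) monoid_scheme \<Rightarrow> bool" where
  "nilpotent_group G \<longleftrightarrow> group G \<and> (\<exists>n. lower_central G n = {\<one>\<^bsub>G\<^esub>})"

lemma lower_central_1: "lower_central G (Suc 0) = derived G (carrier G)"
proof -
  have "{x \<otimes>\<^bsub>G\<^esub> y \<otimes>\<^bsub>G\<^esub> inv\<^bsub>G\<^esub> x \<otimes>\<^bsub>G\<^esub> inv\<^bsub>G\<^esub> y | x y. x \<in> carrier G \<and> y \<in> carrier G}
        = derived_set G (carrier G)"
    by blast
  then show ?thesis
    by (simp add: derived_def)
qed

section \<open>Cayley graphs and colorings\<close>

text \<open>An undirected graph is represented by a symmetric arc set; \<open>C\<close> need not be inverse-closed.\<close>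

definition cayley_graph :: "('a, 'b) monoid_scheme \<Rightarrow> 'a set \<Rightarrow> 'a pair_pre_digraph" where
  "cayley_graph G C =
     \<lparr> pverts = carrier G,
       parcs = {(a, b). a \<in> carrier G \<and> b \<in> carrier G \<and>
                        (inv\<^bsub>G\<^esub> a \<otimes>\<^bsub>G\<^esub> b \<in> C \<or> inv\<^bsub>G\<^esub> b \<otimes>\<^bsub>G\<^esub> a \<in> C)} \<rparr>"

definition colorable :: "nat \<Rightarrow> 'v pair_pre_digraph \<Rightarrow> bool" where
  "colorable k H \<longleftrightarrow>
     (\<exists>f :: 'v \<Rightarrow> nat. (\<forall>v \<in> pverts H. f v < k) \<and> (\<forall>(u, v) \<in> parcs H. f u \<noteq> f v))"

lemma sym_digraph_cayley_graph: "sym_digraph (with_proj (cayley_graph G C))"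
  by unfold_locales (auto simp: cayley_graph_def symmetric_def sym_def)

end

theory Submission
  imports Defs "HOL-Number_Theory.Cong"
begin

text \<open>
  For each \<open>c \<in> C\<close>, minimality and Zorn's lemma give a maximal subgroup \<open>M\<close> that contains
  \<open>C - {c}\<close> but not \<open>c\<close>. As \<open>M\<close> contains the commutator subgroup, it is normal, and the quotient
  by it is a nontrivial cyclic group generated by the image of \<open>c\<close>, whose Cayley graph is a cycle,
  an edge or a two-way infinite path, hence 3-colourable. So \<open>Cay(G, C)\<close> maps to a Cartesian
  product of such graphs, and adding the colours of the coordinates modulo 3 colours it. In a
  nilpotent group every maximal subgroup contains the commutator subgroup, so the same argument
  applies.
\<close>

section \<open>Maximal subgroups avoiding a given element, and normality\<close>

text \<open>Zorn's lemma is applied to the subgroups that contain \<open>H\<close> and avoid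
  \<open>c\<close>. Any subgroup strictly above a maximal member must contain \<open>c\<close>,
  hence all of \<open>insert c H\<close>, so it is the whole group.\<close>

lemma (in group) exists_maximal_subgroup_avoiding:
  assumes H: "subgroup H G" and c: "c \<in> carrier G" "c \<notin> H"
    and gen: "generate G (insert c H) = carrier G"
  shows "\<exists>M. maximal_subgroup M G \<and> H \<subseteq> M \<and> c \<notin> M"
proof -
  define \<A> where "\<A> = {K. subgroup K G \<and> H \<subseteq> K \<and> c \<notin> K}"
  have "\<exists>M\<in>\<A>. \<forall>K\<in>\<A>. M \<subseteq> K \<longrightarrow> K = M"
  proof (rule subset_Zorn_nonempty)
    show "\<A> \<noteq> {}" using H c unfolding \<A>_def by blast
  next
    fix \<C> assume ne: "\<C> \<noteq> {}" and chain: "subset.chain \<A> \<C>"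
    have sub: "K \<in> \<C> \<Longrightarrow> subgroup K G" for K
      using chain by (auto simp: subset.chain_def \<A>_def)
    have "subgroup (\<Union>\<C>) G"
    proof (rule subgroupI)
      show "\<Union>\<C> \<subseteq> carrier G" using subgroup.subset[OF sub] by blast
      show "\<Union>\<C> \<noteq> {}" using ne subgroup.one_closed[OF sub] by blast
      show "inv a \<in> \<Union>\<C>" if "a \<in> \<Union>\<C>" for a
        using that subgroup.m_inv_closed[OF sub] by blast
      show "a \<otimes> b \<in> \<Union>\<C>" if ab: "a \<in> \<Union>\<C>" "b \<in> \<Union>\<C>" for a b
      proof -
        obtain A B where AB: "A \<in> \<C>" "B \<in> \<C>" "a \<in> A" "b \<in> B" using ab by blast
        then have "A \<subseteq> B \<or> B \<subseteq> A" using chain unfolding subset_chain_def by blast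
        then obtain E where "E \<in> \<C>" "a \<in> E" "b \<in> E" using AB by blast
        then show ?thesis using subgroup.m_closed[OF sub] by blast
      qed
    qed
    then show "\<Union>\<C> \<in> \<A>" using ne chain by (auto simp: subset.chain_def \<A>_def)
  qed
  then obtain M where M_in: "M \<in> \<A>" and M_max: "\<forall>K\<in>\<A>. M \<subseteq> K \<longrightarrow> K = M" ..
  have M: "subgroup M G" "H \<subseteq> M" "c \<notin> M" using M_in by (simp_all add: \<A>_def)
  have "K = M \<or> K = carrier G" if K: "subgroup K G" "M \<subseteq> K" for K
  proof (cases "c \<in> K")
    case True
    then have "generate G (insert c H) \<subseteq> K"
      using K(2) M(2) by (intro generate_subgroup_incl[OF _ K(1)]) auto
    then show ?thesis using gen subgroup.subset[OF K(1)] by blast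
  next
    case False
    then have "K \<in> \<A>" using K M(2) by (auto simp: \<A>_def)
    then show ?thesis using M_max K(2) by simp
  qed
  moreover have "M \<noteq> carrier G" using M(3) c(1) by auto
  ultimately have "maximal_subgroup M G" using \<open>subgroup M G\<close> unfolding maximal_subgroup_def by blast
  then show ?thesis using M by auto
qed

text \<open>A conjugate differs from \<open>k\<close> by a commutator:
  \<open>g k g^-1 = [g, k] k\<close>.\<close>

lemma (in group) derived_subset_imp_normal:
  assumes K: "subgroup K G" and D: "derived G (carrier G) \<subseteq> K"
  shows "K \<lhd> G"
  unfolding normal_inv_iff
proof (intro conjI ballI K)
  fix g k assume g: "g \<in> carrier G" and k: "k \<in> K"
  have kG: "k \<in> carrier G" using k K subgroup.subset by blast
  have "g \<otimes> k \<otimes> inv g \<otimes> inv k \<in> derived_set G (carrier G)" using g kG by auto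
  then have "g \<otimes> k \<otimes> inv g \<otimes> inv k \<in> K"
    using D unfolding derived_def by (blast intro: generate.incl)
  then have "g \<otimes> k \<otimes> inv g \<otimes> inv k \<otimes> k \<in> K" using k by (rule subgroup.m_closed[OF K])
  then show "g \<otimes> k \<otimes> inv g \<in> K" using g kG by (simp add: m_assoc)
qed

section \<open>Colouring cyclic groups and pulling back along homomorphisms\<close>

text \<open>The parity of the exponent colours a two-way infinite path or an even cycle; an odd
  cycle gets the third colour at its last residue.\<close>

lemma (in group) cyclic_colouring:
  assumes a: "a \<in> carrier G" "a \<noteq> \<one>"
  shows "\<exists>\<chi> :: 'a \<Rightarrow> nat. \<forall>n :: int. \<chi> (a [^] n) < 3 \<and> \<chi> (a [^] (n + 1)) \<noteq> \<chi> (a [^] n)"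
proof -
  \<comment> \<open>\<open>ord a\<close> is 0 when \<open>a\<close> has infinite order. Then
    \<open>n mod p\<close> is \<open>n\<close>, so one formula for \<psi> serves paths and cycles.
    The case \<open>p = 1\<close>, a loop, is excluded by \<open>a \<noteq> \<one>\<close>.\<close>
  define p where "p = int (ord a)"
  have p: "p \<noteq> 1" "p \<ge> 0" using a ord_eq_1 unfolding p_def by auto
  have eq: "a [^] m = a [^] n \<longleftrightarrow> p dvd n - m" for m n :: int
    using int_pow_eq[OF a(1)] unfolding p_def by simp
  define \<psi> :: "int \<Rightarrow> nat" where
    "\<psi> n = (if odd p \<and> n mod p = p - 1 then 2 else nat ((n mod p) mod 2))" for n
  have per: "\<psi> m = \<psi> n" if "a [^] m = a [^] n" for m n :: int
    using that eq unfolding \<psi>_def by (metis mod_eq_dvd_iff)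
  have step: "\<psi> (n + 1) \<noteq> \<psi> n" for n
  proof (cases "p = 0")
    case True
    have "(n + 1) mod 2 \<noteq> n mod 2" by presburger
    then show ?thesis using True unfolding \<psi>_def by simp
  next
    case False
    then have p2: "p \<ge> 2" using p by linarith
    define r where "r = n mod p"
    have r: "0 \<le> r" "r < p" using p2 unfolding r_def by auto
    have s: "(n + 1) mod p = (if r = p - 1 then 0 else r + 1)"
    proof -
      have "(n + 1) mod p = (r + 1) mod p" unfolding r_def by (simp add: mod_add_left_eq)
      also have "\<dots> = (if r = p - 1 then 0 else r + 1)" using r by auto
      finally show ?thesis .
    qed
    have "(r + 1) mod 2 \<noteq> r mod 2" by presburger
    then have "nat ((r + 1) mod 2) \<noteq> nat (r mod 2)" by (simp add: nat_eq_iff)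
    moreover have "nat (r mod 2) \<noteq> 2" "nat ((r + 1) mod 2) \<noteq> 2" by (simp_all add: nat_eq_iff)
    \<comment> \<open>This is the edge closing an even cycle: the last residue is odd, while residue
      0 has colour 0.\<close>
    moreover have "nat (r mod 2) \<noteq> 0" if "even p" "r = p - 1"
      using that by (simp add: odd_iff_mod_2_eq_one[symmetric] mod_2_eq_odd)
    ultimately show ?thesis unfolding \<psi>_def s r_def[symmetric] using p2 by auto
  qed
  \<comment> \<open>By \<open>per\<close>, the choice of exponent does not affect the
    colour.\<close>
  define \<chi> where "\<chi> x = \<psi> (SOME n. x = a [^] n)" for x
  have chi: "\<chi> (a [^] n) = \<psi> n" for n :: int
    unfolding \<chi>_def by (rule per, rule someI[of "\<lambda>m. a [^] n = a [^] m" n, symmetric]) simp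
  have "\<psi> n < 3" for n unfolding \<psi>_def by auto
  then show ?thesis using step chi by metis
qed

text \<open>All generators except \<open>c\<close> die under \<open>h\<close>, so the image is
  cyclic, generated by \<open>h c\<close>. Right multiplication by \<open>c\<close> raises the
  exponent by one, and the other generators leave it fixed; the colouring of the image is pulled
  back along \<open>h\<close>.\<close>

lemma (in group_hom) colouring_along_generator:
  assumes C: "C \<subseteq> carrier G" "generate G C = carrier G" and c: "c \<in> C" "h c \<noteq> \<one>\<^bsub>H\<^esub>"
    and triv: "\<And>d. d \<in> C \<Longrightarrow> d \<noteq> c \<Longrightarrow> h d = \<one>\<^bsub>H\<^esub>"
  shows "\<exists>\<chi> :: 'a \<Rightarrow> nat. \<forall>g\<in>carrier G. \<chi> g < 3 \<and> \<chi> (g \<otimes> c) \<noteq> \<chi> g \<and>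
           (\<forall>d\<in>C. d \<noteq> c \<longrightarrow> \<chi> (g \<otimes> d) = \<chi> g)"
proof -
  have hc: "h c \<in> carrier H" using C c by auto
  have "h ` carrier G = generate H (h ` C)" using generate_img[OF C(1)] C(2) by simp
  also have "\<dots> \<subseteq> generate H {h c}"
  proof (rule H.generate_subgroup_incl)
    show "h ` C \<subseteq> generate H {h c}"
      using triv generate.one[of H "{h c}"] generate.incl[of "h c" "{h c}" H] by force
    show "subgroup (generate H {h c}) H" using hc by (simp add: H.generate_is_subgroup)
  qed
  also have "\<dots> = {h c [^]\<^bsub>H\<^esub> n | n :: int. n \<in> UNIV}" using H.generate_pow[OF hc] by simp
  finally have pow: "\<exists>n :: int. h g = h c [^]\<^bsub>H\<^esub> n" if "g \<in> carrier G" for g using that by blast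
  obtain \<chi> :: "'c \<Rightarrow> nat" where chi: "\<And>n :: int. \<chi> (h c [^]\<^bsub>H\<^esub> n) < 3"
    "\<And>n :: int. \<chi> (h c [^]\<^bsub>H\<^esub> (n + 1)) \<noteq> \<chi> (h c [^]\<^bsub>H\<^esub> n)"
    using H.cyclic_colouring[OF hc c(2)] by blast
  have "\<chi> (h g) < 3 \<and> \<chi> (h (g \<otimes> c)) \<noteq> \<chi> (h g) \<and>
         (\<forall>d\<in>C. d \<noteq> c \<longrightarrow> \<chi> (h (g \<otimes> d)) = \<chi> (h g))" if g: "g \<in> carrier G" for g
  proof -
    obtain n :: int where n: "h g = h c [^]\<^bsub>H\<^esub> n" using pow g by blast
    have "h (g \<otimes> c) = h c [^]\<^bsub>H\<^esub> (n + 1)" using g c C hc n by (auto simp: H.int_pow_mult)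
    moreover have "h (g \<otimes> d) = h g" if "d \<in> C" "d \<noteq> c" for d
      using that triv g C by auto
    ultimately show ?thesis using chi n by auto
  qed
  then show ?thesis by (intro exI[of _ "\<chi> \<circ> h"]) auto
qed

section \<open>Combining the coordinate colourings\<close>

text \<open>The hypothesis on maximal subgroups is the common ground of the Frattini and nilpotent
  cases.\<close>

lemma (in group) colorable_cayley_graph:
  assumes max: "\<And>M. maximal_subgroup M G \<Longrightarrow> derived G (carrier G) \<subseteq> M"
    and fin: "finite C" and C: "minimal_generating_set G C"
  shows "colorable 3 (cayley_graph G C)"
proof -
  have CG: "C \<subseteq> carrier G" and gen: "generate G C = carrier G"
    and min: "\<And>D. D \<subset> C \<Longrightarrow> generate G D \<noteq> carrier G"
    using C unfolding minimal_generating_set_def by auto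
  have "\<exists>\<chi> :: 'a \<Rightarrow> nat. \<forall>g\<in>carrier G. \<chi> g < 3 \<and> \<chi> (g \<otimes> c) \<noteq> \<chi> g \<and>
           (\<forall>d\<in>C. d \<noteq> c \<longrightarrow> \<chi> (g \<otimes> d) = \<chi> g)" if c: "c \<in> C" for c
  proof -
    let ?H = "generate G (C - {c})"
    have H: "subgroup ?H G" using CG by (intro generate_is_subgroup) auto
    have sub: "C - {c} \<subseteq> ?H" by (auto intro: generate.incl)
    have "c \<notin> ?H"
    proof
      assume "c \<in> ?H"
      then have "generate G C \<subseteq> ?H" using sub by (intro generate_subgroup_incl[OF _ H]) auto
      then show False using min[of "C - {c}"] c gen subgroup.subset[OF H] by blast
    qed
    moreover have "generate G (insert c ?H) = carrier G"
    proof
      show "generate G (insert c ?H) \<subseteq> carrier G"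
        using c CG subgroup.subset[OF H] by (intro generate_incl) auto
      show "carrier G \<subseteq> generate G (insert c ?H)"
        unfolding gen[symmetric] using sub by (intro mono_generate) auto
    qed
    ultimately obtain M where M: "maximal_subgroup M G" "?H \<subseteq> M" "c \<notin> M"
      using exists_maximal_subgroup_avoiding[OF H] c CG by blast
    then have MG: "subgroup M G" by (simp add: maximal_subgroup_def)
    interpret M: normal M G by (rule derived_subset_imp_normal[OF MG max[OF M(1)]])
    interpret \<pi>: group_hom G "G Mod M" "\<lambda>x. M #> x"
      by (intro group_hom.intro group_hom_axioms.intro M.r_coset_hom_Mod M.factorgroup_is_group
          is_group)
    show ?thesis
    proof (rule \<pi>.colouring_along_generator[OF CG gen c])
      show "M #> c \<noteq> \<one>\<^bsub>G Mod M\<^esub>"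
        using M(3) c CG MG coset_join1[of M c] subgroup.subset[OF MG] by auto
      show "M #> d = \<one>\<^bsub>G Mod M\<^esub>" if "d \<in> C" "d \<noteq> c" for d
      proof -
        have "d \<in> M" using that sub M(2) by blast
        then show ?thesis using that CG MG by (auto simp: coset_join2)
      qed
    qed
  qed
  then obtain \<chi> :: "'a \<Rightarrow> 'a \<Rightarrow> nat" where
    chi: "\<And>c g. c \<in> C \<Longrightarrow> g \<in> carrier G \<Longrightarrow> \<chi> c g < 3 \<and> \<chi> c (g \<otimes> c) \<noteq> \<chi> c g \<and>
           (\<forall>d\<in>C. d \<noteq> c \<longrightarrow> \<chi> c (g \<otimes> d) = \<chi> c g)" by metis
  \<comment> \<open>Along an edge labelled \<open>c\<close> only the summand of \<open>c\<close>
    changes, between distinct values below 3, so the sum changes modulo 3.\<close>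
  define f where "f g = (\<Sum>c\<in>C. \<chi> c g) mod 3" for g
  have step: "f (g \<otimes> c) \<noteq> f g" if c: "c \<in> C" and g: "g \<in> carrier G" for c g
  proof -
    let ?s = "\<Sum>d\<in>C-{c}. \<chi> d g"
    have "(\<Sum>d\<in>C-{c}. \<chi> d (g \<otimes> c)) = ?s"
      using chi g c by (intro sum.cong) auto
    then have e: "f (g \<otimes> c) = (\<chi> c (g \<otimes> c) + ?s) mod 3" "f g = (\<chi> c g + ?s) mod 3"
      unfolding f_def using sum.remove[OF fin c, of "\<lambda>d. \<chi> d (g \<otimes> c)"]
        sum.remove[OF fin c, of "\<lambda>d. \<chi> d g"] by simp_all
    have "\<chi> c (g \<otimes> c) < 3" "\<chi> c g < 3" "\<chi> c (g \<otimes> c) \<noteq> \<chi> c g"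
      using chi[OF c g] chi[OF c m_closed[OF g subsetD[OF CG c]]] by blast+
    then show ?thesis
      using cong_add_rcancel_nat[of "\<chi> c (g \<otimes> c)" ?s "\<chi> c g" 3] unfolding e cong_def by simp
  qed
  have edge: "f u \<noteq> f v" if "u \<in> carrier G" "v \<in> carrier G" "inv u \<otimes> v \<in> C" for u v
    using step[OF that(3,1)] that(1,2) by (simp add: m_assoc[symmetric])
  show ?thesis unfolding colorable_def
  proof (intro exI[of _ f] conjI ballI)
    show "f v < 3" for v by (simp add: f_def)
    show "case e of (u, v) \<Rightarrow> f u \<noteq> f v" if "e \<in> parcs (cayley_graph G C)" for e
      using that edge by (fastforce simp: cayley_graph_def)
  qed
qed

section \<open>Maximal subgroups of nilpotent groups\<close>

lemma (in group) lower_central_subset_carrier: "lower_central G n \<subseteq> carrier G"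
proof (induction n)
  case (Suc n)
  then show ?case unfolding lower_central.simps by (intro generate_incl) auto
qed simp

text \<open>
  \<open>M\<close> need not be normal: with commutators \<open>[a, b] = a b a\<^sup>-\<^sup>1 b\<^sup>-\<^sup>1\<close>, closure under products follows
  from \<open>[z w, y] = [z, [w, y]] [w, y] [z, y]\<close>.
\<close>

lemma (in group) subgroup_central_modulo:
  assumes M: "subgroup M G"
  shows "subgroup {z \<in> carrier G. \<forall>y\<in>carrier G. z \<otimes> y \<otimes> inv z \<otimes> inv y \<in> M} G" (is "subgroup ?Z G")
proof (rule subgroupI)
  show "?Z \<subseteq> carrier G" by blast
  have "\<one> \<in> ?Z" using subgroup.one_closed[OF M] by auto
  then show "?Z \<noteq> {}" by blast
next
  fix z assume z: "z \<in> ?Z"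
  have "inv z \<otimes> y \<otimes> inv (inv z) \<otimes> inv y \<in> M" if y: "y \<in> carrier G" for y
  proof -
    \<comment> \<open>The conjugate \<open>z^-1 y z\<close> is chosen because
      \<open>[z, z^-1 y z]\<close> is the inverse of \<open>[z^-1, y]\<close>.\<close>
    have "z \<otimes> (inv z \<otimes> y \<otimes> z) \<otimes> inv z \<otimes> inv (inv z \<otimes> y \<otimes> z) \<in> M" using z y by auto
    then have "inv (z \<otimes> (inv z \<otimes> y \<otimes> z) \<otimes> inv z \<otimes> inv (inv z \<otimes> y \<otimes> z)) \<in> M"
      using subgroup.m_inv_closed[OF M] by blast
    also have "inv (z \<otimes> (inv z \<otimes> y \<otimes> z) \<otimes> inv z \<otimes> inv (inv z \<otimes> y \<otimes> z))
                 = inv z \<otimes> y \<otimes> inv (inv z) \<otimes> inv y"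
      using z y by (simp add: inv_mult_group m_assoc[symmetric])
    finally show ?thesis .
  qed
  then show "inv z \<in> ?Z" using z by auto
next
  fix z w assume z: "z \<in> ?Z" and w: "w \<in> ?Z"
  have "z \<otimes> w \<otimes> y \<otimes> inv (z \<otimes> w) \<otimes> inv y \<in> M" if y: "y \<in> carrier G" for y
  proof -
    define k where "k = w \<otimes> y \<otimes> inv w \<otimes> inv y"
    have kM: "k \<in> M" and k: "k \<in> carrier G" using w y by (auto simp: k_def)
    have "z \<otimes> k \<otimes> inv z \<otimes> inv k \<in> M" "z \<otimes> y \<otimes> inv z \<otimes> inv y \<in> M" using z k y by auto
    then have "(z \<otimes> k \<otimes> inv z \<otimes> inv k) \<otimes> k \<otimes> (z \<otimes> y \<otimes> inv z \<otimes> inv y) \<in> M"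
      using kM subgroup.m_closed[OF M] by blast
    also have "(z \<otimes> k \<otimes> inv z \<otimes> inv k) \<otimes> k \<otimes> (z \<otimes> y \<otimes> inv z \<otimes> inv y)
                 = z \<otimes> k \<otimes> y \<otimes> inv z \<otimes> inv y"
      using z k y by (simp add: m_assoc) (simp flip: m_assoc)
    also have "\<dots> = z \<otimes> w \<otimes> y \<otimes> inv (z \<otimes> w) \<otimes> inv y"
      using z w y by (simp add: k_def m_assoc inv_mult_group)
    finally show ?thesis .
  qed
  then show "z \<otimes> w \<in> ?Z" using z w by auto
qed

text \<open>This is the normalizer of \<open>M\<close>; requiring both conjugations makes closure
  under inverses immediate.\<close>

lemma (in group) subgroup_normalizing:
  assumes M: "subgroup M G"
  shows "subgroup {g \<in> carrier G. \<forall>m\<in>M. g \<otimes> m \<otimes> inv g \<in> M \<and> inv g \<otimes> m \<otimes> g \<in> M} G"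
    (is "subgroup ?N G")
proof (rule subgroupI)
  show "?N \<subseteq> carrier G" by blast
  have "\<one> \<in> ?N" using subgroup.subset[OF M] by auto
  then show "?N \<noteq> {}" by blast
  show "inv g \<in> ?N" if "g \<in> ?N" for g using that by auto
next
  fix g h assume g: "g \<in> ?N" and h: "h \<in> ?N"
  have "g \<otimes> h \<otimes> m \<otimes> inv (g \<otimes> h) \<in> M \<and> inv (g \<otimes> h) \<otimes> m \<otimes> (g \<otimes> h) \<in> M" if m: "m \<in> M" for m
  proof
    have mG: "m \<in> carrier G" using m subgroup.subset[OF M] by blast
    have "g \<otimes> (h \<otimes> m \<otimes> inv h) \<otimes> inv g \<in> M" "inv h \<otimes> (inv g \<otimes> m \<otimes> g) \<otimes> h \<in> M"
      using g h m by auto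
    then show "g \<otimes> h \<otimes> m \<otimes> inv (g \<otimes> h) \<in> M" "inv (g \<otimes> h) \<otimes> m \<otimes> (g \<otimes> h) \<in> M"
      using g h mG by (simp_all add: m_assoc inv_mult_group)
  qed
  then show "g \<otimes> h \<in> ?N" using g h by auto
qed

text \<open>An element \<open>x\<close> outside \<open>M\<close> that is central modulo
  \<open>M\<close> normalizes \<open>M\<close>, so maximality makes the normalizer \<open>N\<close>
  all of \<open>G\<close>. Then \<open>M\<close> lies in \<open>Z\<close>, the elements central
  modulo \<open>M\<close>; since \<open>x\<close> is in \<open>Z\<close> too, maximality gives
  \<open>Z = G\<close>.\<close>

lemma (in group) nilpotent_derived_subset_maximal:
  assumes nil: "lower_central G n = {\<one>}" and max: "maximal_subgroup M G"
  shows "derived G (carrier G) \<subseteq> M"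
proof -
  have M: "subgroup M G" and proper: "M \<noteq> carrier G"
    and maxD: "\<And>H. subgroup H G \<Longrightarrow> M \<subseteq> H \<Longrightarrow> H \<noteq> M \<Longrightarrow> H = carrier G"
    using max unfolding maximal_subgroup_def by auto
  note MG = subgroup.subset[OF M]
  have "lower_central G n \<subseteq> M" using nil subgroup.one_closed[OF M] by simp
  moreover have "\<not> lower_central G 0 \<subseteq> M" using MG proper by auto
  \<comment> \<open>The series starts outside \<open>M\<close> and ends inside it, so it enters
    \<open>M\<close> at some step. The commutators of any \<open>x\<close> in term \<open>k\<close>
    then lie in \<open>M\<close>.\<close>
  ultimately obtain k where k: "\<not> lower_central G k \<subseteq> M" "lower_central G (Suc k) \<subseteq> M"
    by (induction n) blast+
  then obtain x where x: "x \<in> lower_central G k" "x \<notin> M" by blast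
  have xG: "x \<in> carrier G" using x lower_central_subset_carrier by blast
  define Z where "Z = {z \<in> carrier G. \<forall>y\<in>carrier G. z \<otimes> y \<otimes> inv z \<otimes> inv y \<in> M}"
  have Z: "subgroup Z G" unfolding Z_def by (rule subgroup_central_modulo[OF M])
  have xZ: "x \<in> Z"
    using k(2) x(1) xG unfolding Z_def by (auto intro!: generate.incl subsetD[OF k(2)]) blast
  define N where "N = {g \<in> carrier G. \<forall>m\<in>M. g \<otimes> m \<otimes> inv g \<in> M \<and> inv g \<otimes> m \<otimes> g \<in> M}"
  have N: "subgroup N G" unfolding N_def by (rule subgroup_normalizing[OF M])
  have conj: "z \<otimes> m \<otimes> inv z \<in> M" if z: "z \<in> Z" and m: "m \<in> M" for z m
  proof -
    have "z \<otimes> m \<otimes> inv z \<otimes> inv m \<otimes> m \<in> M"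
      using z m MG subgroup.m_closed[OF M] unfolding Z_def by blast
    moreover have "z \<otimes> m \<otimes> inv z \<otimes> inv m \<otimes> m = z \<otimes> m \<otimes> inv z"
      using z m MG unfolding Z_def by (auto simp: m_assoc)
    ultimately show ?thesis by simp
  qed
  have "x \<in> N"
    using conj[OF xZ] conj[OF subgroup.m_inv_closed[OF Z xZ]] xG unfolding N_def by simp
  moreover have "M \<subseteq> N"
    using MG by (auto simp: N_def subset_iff
        intro!: subgroup.m_closed[OF M] subgroup.m_inv_closed[OF M])
  ultimately have NG: "N = carrier G" using maxD[OF N] x(2) by blast
  have "M \<subseteq> Z"
  proof
    fix m assume m: "m \<in> M"
    have "m \<otimes> y \<otimes> inv m \<otimes> inv y \<in> M" if y: "y \<in> carrier G" for y
    proof -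
      \<comment> \<open>Normality of \<open>M\<close> puts \<open>[m, y] = m (y m^-1 y^-1)\<close>
        into \<open>M\<close>.\<close>
      have "y \<otimes> inv m \<otimes> inv y \<in> M"
        using y m NG subgroup.m_inv_closed[OF M] unfolding N_def by blast
      then have "m \<otimes> (y \<otimes> inv m \<otimes> inv y) \<in> M" using m subgroup.m_closed[OF M] by blast
      then show ?thesis using m MG y by (auto simp: m_assoc subset_iff)
    qed
    then show "m \<in> Z" using m MG unfolding Z_def by blast
  qed
  then have "Z = carrier G" using maxD[OF Z] xZ x(2) by blast
  then have "derived_set G (carrier G) \<subseteq> M" unfolding Z_def by blast
  then show ?thesis unfolding derived_def by (rule generate_subgroup_incl[OF _ M])
qed

theorem theorem2p8:
  fixes G :: "('a, 'b) monoid_scheme"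
  assumes "group G" and "finitely_generated G"
  shows "(derived G (carrier G) \<subseteq> frattini G \<longrightarrow>
            (\<forall>C. finite C \<and> minimal_generating_set G C \<longrightarrow> colorable 3 (cayley_graph G C)))
       \<and> (nilpotent_group G \<longrightarrow>
            (\<forall>C. finite C \<and> minimal_generating_set G C \<longrightarrow> colorable 3 (cayley_graph G C)))"
proof -
  interpret group G by fact
  \<comment> \<open>The given \<open>M\<close> selects the intersection branch of
    \<open>frattini\<close>.\<close>
  have frat: "derived G (carrier G) \<subseteq> M"
    if "derived G (carrier G) \<subseteq> frattini G" "maximal_subgroup M G" for M
    using that unfolding frattini_def by (auto split: if_splits)
  have nil: "derived G (carrier G) \<subseteq> M" if "nilpotent_group G" "maximal_subgroup M G" for M
    using that nilpotent_derived_subset_maximal unfolding nilpotent_group_def by blast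
  show ?thesis using colorable_cayley_graph frat nil by blast
qed

end
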